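(* Let $X$ be a finite-dimensional real Hilbert space, let $m\in\mathbb{N}$, $I:=\{1,2,\ldots,m\}$, and let $\{T_i\}_{i\in I}$ be continuous cutters defined on $X$ with fixed point sets $F_i:=\mathrm{Fix}(T_i)$ and common fixed point set $F:=\bigcap_{i\in I}F_i\neq\emptyset$. Let $\{w_k\}_{k=0}^{\infty}$ be a sequence of weight functions on $I$, let $\tau_1,\tau_2\in(0,1]$, let $x^0\in X$ be arbitrary, and let $\{x^k\}_{k=0}^{\infty}$ be a sequence satisfying, for all $k\in\mathbb{N}\cup\{0\}$, $$x^{k+1}=T_{w_k,\lambda_k}(x^k)=x^k+\lambda_k\Big(\sum_{i\in I}w_k(i)T_i(x^k)-x^k\Big),$$ where $\lambda_k\in[\tau_1,(2-\tau_2)L(x^k,w_k)]$ for all $k\in\mathbb{N}\cup\{0\}$. Suppose that there are $s\in\mathbb{N}$ and $\alpha>0$ such that for all $i\in I$ and all $\ell\in\mathbb{N}\cup\{0\}$ there is some $k\in\{\ell,\ell+1,\ldots,\ell+s-1\}$ such that $w_k(i)\ge\alpha$. Then $\{x^k\}_{k=0}^{\infty}$ converges to a point $x^{\ast}\in F$.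
   Context: An operator $T:X\to X$ on a real Hilbert space is called a cutter if $\mathrm{Fix}(T):=\{x\in X\mid T(x)=x\}\neq\emptyset$ and $\langle x-T(x),q-T(x)\rangle\le 0$ for all $x\in X$ and all $q\in\mathrm{Fix}(T)$. A weight function on $I=\{1,\ldots,m\}$ is a function $w:I\to[0,1]$ with $\sum_{i\in I}w(i)=1$. For a weight function $w$ and operators $T_i:X\to X$, $i\in I$, put $T_w(x):=\sum_{i\in I}w(i)T_i(x)$ and, for $\lambda\in\mathbb{R}$, $T_{w,\lambda}(x):=x+\lambda(T_w(x)-x)$. Define $L(x,w):=\dfrac{\sum_{i\in I}w(i)\|T_i(x)-x\|^2}{\|T_w(x)-x\|^2}$ if $T_w(x)\neq x$, and $L(x,w):=1$ otherwise. *)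

theory Defs
  imports "HOL-Analysis.Analysis"
begin

definition Fix :: "('a \<Rightarrow> 'a) \<Rightarrow> 'a set" where
  "Fix T = {x. T x = x}"

definition cutter :: "('a::real_inner \<Rightarrow> 'a) \<Rightarrow> bool" where
  "cutter T \<longleftrightarrow> Fix T \<noteq> {} \<and> (\<forall>x. \<forall>q\<in>Fix T. (x - T x) \<bullet> (q - T x) \<le> 0)"

text \<open>Families indexed by \<open>I\<close> are total functions on the index type; everything below
  depends only on their values on \<open>I\<close>, which is meant to be finite.\<close>

definition weight_function :: "'i set \<Rightarrow> ('i \<Rightarrow> real) \<Rightarrow> bool" where
  "weight_function I w \<longleftrightarrow> (\<forall>i\<in>I. 0 \<le> w i \<and> w i \<le> 1) \<and> (\<Sum>i\<in>I. w i) = 1"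

definition weighted_op ::
    "'i set \<Rightarrow> ('i \<Rightarrow> 'a \<Rightarrow> 'a) \<Rightarrow> ('i \<Rightarrow> real) \<Rightarrow> 'a \<Rightarrow> 'a::real_inner" where
  "weighted_op I T w x = (\<Sum>i\<in>I. w i *\<^sub>R T i x)"

definition relaxed_op ::
    "'i set \<Rightarrow> ('i \<Rightarrow> 'a \<Rightarrow> 'a) \<Rightarrow> ('i \<Rightarrow> real) \<Rightarrow> real \<Rightarrow> 'a \<Rightarrow> 'a::real_inner" where
  "relaxed_op I T w l x = x + l *\<^sub>R (weighted_op I T w x - x)"

definition extrapolation ::
    "'i set \<Rightarrow> ('i \<Rightarrow> 'a \<Rightarrow> 'a::real_inner) \<Rightarrow> 'a \<Rightarrow> ('i \<Rightarrow> real) \<Rightarrow> real" where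
  "extrapolation I T x w =
    (if weighted_op I T w x \<noteq> x
     then (\<Sum>i\<in>I. w i * (norm (T i x - x))\<^sup>2) / (norm (weighted_op I T w x - x))\<^sup>2
     else 1)"

end

theory Submission
  imports Defs
begin

text \<open>The argument is one of Fejer monotonicity. Let \<open>q\<close> be a common fixed point. Each cutter
  moves \<open>x\<close> towards \<open>q\<close>, in the sense that
  \<open>\<langle>T\<^sub>i x - x, q - x\<rangle> \<ge> \<parallel>T\<^sub>i x - x\<parallel>\<^sup>2\<close>, and this survives averaging. The upper
  bound on the relaxation parameter is what keeps the step from overshooting: it yields that
  \<open>D\<^sub>k = \<parallel>x\<^sub>k - q\<parallel>\<^sup>2 - \<parallel>x\<^sub>k\<^sub>+\<^sub>1 - q\<parallel>\<^sup>2\<close>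
  dominates, up to constants, both the squared step length
  \<open>\<parallel>x\<^sub>k\<^sub>+\<^sub>1 - x\<^sub>k\<parallel>\<^sup>2\<close> and the weighted residual
  \<open>\<Sum>\<^sub>i w\<^sub>k(i) \<parallel>T\<^sub>i x\<^sub>k - x\<^sub>k\<parallel>\<^sup>2\<close>
  (lemma \<open>relaxed_op_decrease\<close>). The distances to \<open>q\<close> decrease and therefore converge, so
  \<open>D\<^sub>k\<close>, the steps and the weighted residuals all tend to zero.

  The sequence is bounded, so in finite dimension some subsequence converges, say to \<open>x\<^sup>*\<close>.
  A weighted residual says something about the operator \<open>T\<^sub>i\<close> only at indices where its weight
  is not small. Intermittency provides such an index within \<open>s\<close> steps of each member of the
  subsequence, and vanishing steps make the iterates at these indices converge to \<open>x\<^sup>*\<close> too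
  (lemma \<open>vanishing_steps_bounded_shift\<close>). There the residual of \<open>T\<^sub>i\<close> tends to zero, and
  continuity gives \<open>T\<^sub>i x\<^sup>* = x\<^sup>*\<close>. Hence \<open>x\<^sup>*\<close> is itself a common fixed point, the
  distances to it decrease as well, and since they tend to zero along a subsequence, they tend to
  zero (lemma \<open>antimono_distance_subsequence_imp_LIMSEQ\<close>).\<close>

section \<open>Bounded sequences in a finite-dimensional inner product space\<close>

text \<open>The subsequence must serve all coordinates at once: each further vector of \<open>C\<close> is dealt
  with by thinning out the subsequence found for the others.\<close>
lemma convergent_subsequence_finitely_many_coordinates:
  fixes x :: "nat \<Rightarrow> 'a::real_inner"
  assumes "finite C" and "bounded (range x)"
  shows "\<exists>r. strict_mono (r :: nat \<Rightarrow> nat) \<and> (\<forall>c\<in>C. convergent (\<lambda>n. x (r n) \<bullet> c))"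
  using \<open>finite C\<close>
proof (induction C rule: finite_induct)
  case empty
  have "strict_mono (id :: nat \<Rightarrow> nat)"
    by (simp add: strict_mono_def)
  then show ?case
    by blast
next
  case (insert d C)
  then obtain r :: "nat \<Rightarrow> nat" where r: "strict_mono r"
    and conv: "\<forall>c\<in>C. convergent (\<lambda>n. x (r n) \<bullet> c)"
    by blast
  obtain b where b: "\<And>n. norm (x n) \<le> b"
    using \<open>bounded (range x)\<close> by (auto simp: bounded_iff)
  have "norm (x (r n) \<bullet> d) \<le> b * norm d" for n
  proof -
    have "norm (x (r n) \<bullet> d) \<le> norm (x (r n)) * norm d"
      by (simp add: Cauchy_Schwarz_ineq2)
    also have "\<dots> \<le> b * norm d"
      by (simp add: b mult_right_mono)
    finally show ?thesis .
  qed
  then have "bounded (range (\<lambda>n. x (r n) \<bullet> d))"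
    by (auto simp: bounded_iff)
  then obtain l and r' :: "nat \<Rightarrow> nat" where r': "strict_mono r'"
    and l: "((\<lambda>n. x (r n) \<bullet> d) \<circ> r') \<longlonglongrightarrow> l"
    using bounded_imp_convergent_subsequence by blast
  have "convergent (\<lambda>n. x ((r \<circ> r') n) \<bullet> d)"
    using l by (auto simp: convergent_def o_def)
  moreover have "convergent (\<lambda>n. x ((r \<circ> r') n) \<bullet> c)" if "c \<in> C" for c
    using convergent_subseq_convergent[OF _ r', of "\<lambda>n. x (r n) \<bullet> c"] conv that
    by (simp add: o_def)
  ultimately show ?case
    using strict_mono_o[OF r r'] by (intro exI[of _ "r \<circ> r'"]) blast
qed

text \<open>The difference of the two sides is orthogonal to \<open>C\<close>, hence to its span, which contains
  that difference. If \<open>0 \<in> C\<close>, the summand of \<open>0\<close> is \<open>0\<close>.\<close>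
lemma orthogonal_expansion:
  fixes v :: "'a::real_inner"
  assumes "finite C" and "pairwise orthogonal C" and "span C = UNIV"
  shows "(\<Sum>c\<in>C. (v \<bullet> c / (c \<bullet> c)) *\<^sub>R c) = v"
proof -
  define y where "y = v - (\<Sum>c\<in>C. (v \<bullet> c / (c \<bullet> c)) *\<^sub>R c)"
  have "orthogonal y d" if "d \<in> C" for d
  proof -
    have "(\<Sum>c\<in>C. (v \<bullet> c / (c \<bullet> c)) *\<^sub>R c) \<bullet> d = (\<Sum>c\<in>C. if c = d then v \<bullet> d else 0)"
      unfolding inner_sum_left
    proof (rule sum.cong[OF refl])
      fix c
      assume "c \<in> C"
      then show "((v \<bullet> c / (c \<bullet> c)) *\<^sub>R c) \<bullet> d = (if c = d then v \<bullet> d else 0)"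
        using \<open>pairwise orthogonal C\<close> \<open>d \<in> C\<close> by (auto simp: pairwise_def orthogonal_def)
    qed
    then show ?thesis
      using \<open>finite C\<close> \<open>d \<in> C\<close> by (simp add: y_def orthogonal_def inner_diff_left)
  qed
  then have "orthogonal y y"
    using orthogonal_to_span[of y C y] \<open>span C = UNIV\<close> by simp
  then show ?thesis
    by (simp add: y_def orthogonal_self)
qed

text \<open>The Bolzano--Weierstrass property comes with the class of Euclidean spaces, whereas here
  finite dimension is a hypothesis about one space. An orthogonal basis reduces it to the real
  line: boundedness passes to the finitely many coordinates, and convergence passes back.\<close>
lemma finite_dimensional_convergent_subsequence:
  fixes x :: "nat \<Rightarrow> 'a::real_inner"
  assumes "\<exists>B :: 'a set. finite B \<and> span B = UNIV" and "bounded (range x)"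
  obtains l and r :: "nat \<Rightarrow> nat" where "strict_mono r" and "(\<lambda>n. x (r n)) \<longlonglongrightarrow> l"
proof -
  obtain C :: "'a set" where C: "finite C" "span C = UNIV" "pairwise orthogonal C"
    using assms(1) basis_orthogonal by metis
  obtain r :: "nat \<Rightarrow> nat" where r: "strict_mono r"
    and conv: "\<forall>c\<in>C. convergent (\<lambda>n. x (r n) \<bullet> c)"
    using convergent_subsequence_finitely_many_coordinates[OF C(1) assms(2)] by blast
  then obtain a where a: "\<And>c. c \<in> C \<Longrightarrow> (\<lambda>n. x (r n) \<bullet> c) \<longlonglongrightarrow> a c"
    unfolding convergent_def by metis
  have "(\<lambda>n. \<Sum>c\<in>C. (x (r n) \<bullet> c / (c \<bullet> c)) *\<^sub>R c) \<longlonglongrightarrow> (\<Sum>c\<in>C. (a c / (c \<bullet> c)) *\<^sub>R c)"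
    unfolding divide_inverse by (intro tendsto_intros a)
  then have "(\<lambda>n. x (r n)) \<longlonglongrightarrow> (\<Sum>c\<in>C. (a c / (c \<bullet> c)) *\<^sub>R c)"
    by (simp add: orthogonal_expansion[OF C(1,3,2)])
  then show thesis
    using that r by blast
qed

section \<open>Decrease of the distance to common fixed points\<close>

lemma cutter_inner_ge:
  assumes "cutter T" and "q \<in> Fix T"
  shows "(norm (T x - x))\<^sup>2 \<le> (T x - x) \<bullet> (q - x)"
proof -
  have "(x - T x) \<bullet> (q - T x) \<le> 0"
    using assms by (auto simp: cutter_def)
  then show ?thesis
    unfolding power2_norm_eq_inner by (simp add: algebra_simps inner_commute)
qed

text \<open>The weights sum to one, so \<open>x\<close> may be moved into the average.\<close>
lemma weighted_op_displacement:
  assumes "weight_function I w"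
  shows "weighted_op I T w x - x = (\<Sum>i\<in>I. w i *\<^sub>R (T i x - x))"
proof -
  have "(\<Sum>i\<in>I. w i *\<^sub>R x) = x"
    using assms by (simp add: weight_function_def flip: scaleR_sum_left)
  then show ?thesis
    by (simp add: weighted_op_def scaleR_diff_right sum_subtractf)
qed

lemma weighted_op_inner_ge:
  assumes "weight_function I w" and "\<And>i. i \<in> I \<Longrightarrow> cutter (T i)"
    and "q \<in> (\<Inter>i\<in>I. Fix (T i))"
  shows "(\<Sum>i\<in>I. w i * (norm (T i x - x))\<^sup>2) \<le> (weighted_op I T w x - x) \<bullet> (q - x)"
  unfolding weighted_op_displacement[OF assms(1)] inner_sum_left inner_scaleR_left
  using assms by (intro sum_mono mult_left_mono cutter_inner_ge) (auto simp: weight_function_def)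

text \<open>This is the purpose of the extrapolation bound: with the displacement
  \<open>d = T\<^sub>w x - x\<close> and \<open>S\<close> the weighted sum of the \<open>\<parallel>T\<^sub>i x - x\<parallel>\<^sup>2\<close>, the bound reads
  \<open>\<lambda> \<parallel>d\<parallel>\<^sup>2 \<le> (2 - \<tau>\<^sub>2) S\<close>, also when \<open>d = 0\<close>, while the cutter property gives
  \<open>S \<le> \<langle>d, q - x\<rangle>\<close>. In the expansion
  \<open>\<parallel>x + \<lambda> d - q\<parallel>\<^sup>2 = \<parallel>x - q\<parallel>\<^sup>2 - 2 \<lambda> \<langle>d, q - x\<rangle> + \<lambda>\<^sup>2 \<parallel>d\<parallel>\<^sup>2\<close>
  the quadratic term is therefore absorbed up to a surplus of \<open>\<tau>\<^sub>2 \<lambda> S\<close>.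
  The second inequality bounds the length of the step by the same decrease.\<close>
lemma relaxed_op_decrease:
  fixes T :: "'i \<Rightarrow> 'a::real_inner \<Rightarrow> 'a"
  assumes w: "weight_function I w" and cut: "\<And>i. i \<in> I \<Longrightarrow> cutter (T i)"
    and q: "q \<in> (\<Inter>i\<in>I. Fix (T i))"
    and tau: "0 < tau1" "0 < tau2"
    and l: "tau1 \<le> l" "l \<le> (2 - tau2) * extrapolation I T x w"
  defines "y \<equiv> relaxed_op I T w l x"
  shows "tau1 * tau2 * (\<Sum>i\<in>I. w i * (norm (T i x - x))\<^sup>2) \<le> (norm (x - q))\<^sup>2 - (norm (y - q))\<^sup>2"
    and "tau2 * (norm (y - x))\<^sup>2 \<le> 2 * ((norm (x - q))\<^sup>2 - (norm (y - q))\<^sup>2)"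
proof -
  define d where "d = weighted_op I T w x - x"
  define S where "S = (\<Sum>i\<in>I. w i * (norm (T i x - x))\<^sup>2)"
  have S0: "0 \<le> S"
    unfolding S_def using w by (intro sum_nonneg) (auto simp: weight_function_def)
  have Sd: "S \<le> d \<bullet> (q - x)"
    unfolding S_def d_def using weighted_op_inner_ge[OF w cut q] .
  have ld: "l * (norm d)\<^sup>2 \<le> (2 - tau2) * S"
  proof (cases "d = 0")
    case True
    then show ?thesis using Sd S0 by simp
  next
    case False
    then have "extrapolation I T x w = S / (norm d)\<^sup>2"
      by (simp add: extrapolation_def d_def S_def)
    then have "l \<le> (2 - tau2) * S / (norm d)\<^sup>2"
      using l(2) by simp
    then show ?thesis
      using False by (simp add: pos_le_divide_eq)
  qed
  have l0: "0 < l"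
    using tau l by simp
  have "(norm (y - q))\<^sup>2 = (norm (x - q))\<^sup>2 - 2 * l * (d \<bullet> (q - x)) + l * (l * (norm d)\<^sup>2)"
    unfolding power2_norm_eq_inner y_def relaxed_op_def d_def[symmetric]
    by (simp add: algebra_simps inner_commute)
  moreover have "l * (l * (norm d)\<^sup>2) \<le> l * ((2 - tau2) * S)"
    using ld l0 by simp
  moreover have "l * S \<le> l * (d \<bullet> (q - x))"
    using Sd l0 by simp
  ultimately have dec: "tau2 * (l * S) \<le> (norm (x - q))\<^sup>2 - (norm (y - q))\<^sup>2"
    by (simp add: algebra_simps)
  have "tau2 * (tau1 * S) \<le> tau2 * (l * S)"
    using tau l S0 by (intro mult_left_mono mult_right_mono) auto
  with dec show "tau1 * tau2 * (\<Sum>i\<in>I. w i * (norm (T i x - x))\<^sup>2)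
      \<le> (norm (x - q))\<^sup>2 - (norm (y - q))\<^sup>2"
    by (simp add: S_def mult_ac)
  have "(2 - tau2) * S \<le> 2 * S"
    using S0 tau by (intro mult_right_mono) auto
  with ld have "l * (norm d)\<^sup>2 \<le> 2 * S"
    by (rule order_trans)
  then have "tau2 * (l * (l * (norm d)\<^sup>2)) \<le> tau2 * (l * (2 * S))"
    using tau l0 by (intro mult_left_mono) auto
  moreover have "(norm (y - x))\<^sup>2 = l * (l * (norm d)\<^sup>2)"
    by (simp add: y_def relaxed_op_def d_def power_mult_distrib power2_eq_square)
  ultimately show "tau2 * (norm (y - x))\<^sup>2 \<le> 2 * ((norm (x - q))\<^sup>2 - (norm (y - q))\<^sup>2)"
    using dec by simp
qed

section \<open>Limits along subsequences\<close>

text \<open>The points \<open>x (k n)\<close> and \<open>x (r n)\<close> are separated by at most \<open>s\<close> steps. Their distance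
  is bounded by a sum of exactly \<open>s\<close> step lengths, a number independent of \<open>n\<close>, so the sum
  tends to zero termwise.\<close>
lemma vanishing_steps_bounded_shift:
  fixes x :: "nat \<Rightarrow> 'a::real_normed_vector"
  assumes steps: "(\<lambda>k. x (Suc k) - x k) \<longlonglongrightarrow> 0"
    and r: "filterlim r at_top sequentially"
    and k: "\<And>n. r n \<le> k n" "\<And>n. k n \<le> r n + s"
    and lim: "(\<lambda>n. x (r n)) \<longlonglongrightarrow> a"
  shows "(\<lambda>n. x (k n)) \<longlonglongrightarrow> a"
proof -
  have "(\<lambda>l. \<Sum>i<s. norm (x (Suc (l + i)) - x (l + i))) \<longlonglongrightarrow> (\<Sum>i<s. 0)"
    by (intro tendsto_sum tendsto_norm_zero LIMSEQ_ignore_initial_segment[OF steps])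
  then have "(\<lambda>n. \<Sum>i<s. norm (x (Suc (r n + i)) - x (r n + i))) \<longlonglongrightarrow> 0"
    using filterlim_compose[OF _ r] by fastforce
  moreover have "norm (x (k n) - x (r n)) \<le> (\<Sum>i<s. norm (x (Suc (r n + i)) - x (r n + i)))" for n
  proof -
    define j where "j = k n - r n"
    have j: "k n = r n + j" "j \<le> s"
      using k[of n] by (auto simp: j_def)
    have "x (k n) - x (r n) = (\<Sum>i<j. x (Suc (r n + i)) - x (r n + i))"
      using sum_lessThan_telescope[of "\<lambda>i. x (r n + i)" j] by (simp add: j)
    also have "norm \<dots> \<le> (\<Sum>i<j. norm (x (Suc (r n + i)) - x (r n + i)))"
      by (rule norm_sum)
    also have "\<dots> \<le> (\<Sum>i<s. norm (x (Suc (r n + i)) - x (r n + i)))"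
      using j by (intro sum_mono2) auto
    finally show ?thesis .
  qed
  ultimately have "(\<lambda>n. x (k n) - x (r n)) \<longlonglongrightarrow> 0"
    by (rule Lim_null_comparison[OF always_eventually[OF allI], rotated])
  from tendsto_add[OF this lim] show ?thesis
    by simp
qed

text \<open>A sequence whose distance to \<open>q\<close> never increases has all its cluster points at one common
  distance from \<open>q\<close>; if \<open>q\<close> is itself a cluster point, that distance is zero.\<close>
lemma antimono_distance_subsequence_imp_LIMSEQ:
  fixes x :: "nat \<Rightarrow> 'a::real_normed_vector"
  assumes "\<And>k. norm (x (Suc k) - q) \<le> norm (x k - q)"
    and "strict_mono (r :: nat \<Rightarrow> nat)" and "(\<lambda>n. x (r n)) \<longlonglongrightarrow> q"
  shows "x \<longlonglongrightarrow> q"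
proof -
  have "decseq (\<lambda>k. norm (x k - q))"
    by (rule decseq_SucI) (rule assms(1))
  then obtain L where L: "(\<lambda>k. norm (x k - q)) \<longlonglongrightarrow> L"
    by (rule decseq_convergent[of _ 0]) auto
  have "(\<lambda>n. norm (x (r n) - q)) \<longlonglongrightarrow> L"
    using LIMSEQ_subseq_LIMSEQ[OF L assms(2)] by (simp add: o_def)
  moreover have "(\<lambda>n. norm (x (r n) - q)) \<longlonglongrightarrow> 0"
    by (rule tendsto_norm_zero[OF LIM_zero[OF assms(3)]])
  ultimately have "L = 0"
    by (rule LIMSEQ_unique)
  with L have "(\<lambda>k. norm (x k - q)) \<longlonglongrightarrow> 0"
    by simp
  then have "(\<lambda>k. x k - q) \<longlonglongrightarrow> 0"
    by (rule tendsto_norm_zero_cancel)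
  then show ?thesis
    by (rule LIM_zero_cancel)
qed

section \<open>Convergence of the extrapolated iteration\<close>

theorem theorem4p16:
  fixes T :: "nat \<Rightarrow> 'a::real_inner \<Rightarrow> 'a"
    and m s :: nat
    and w :: "nat \<Rightarrow> nat \<Rightarrow> real"
    and lam :: "nat \<Rightarrow> real"
    and tau1 tau2 alpha :: real
    and x :: "nat \<Rightarrow> 'a"
  assumes fin_dim: "\<exists>B :: 'a set. finite B \<and> span B = UNIV"
    and m: "m \<ge> 1"
    and cutters: "\<forall>i\<in>{1..m}. cutter (T i) \<and> continuous_on UNIV (T i)"
    and common: "(\<Inter>i\<in>{1..m}. Fix (T i)) \<noteq> {}"
    and weights: "\<forall>k. weight_function {1..m} (w k)"
    and tau1: "0 < tau1" "tau1 \<le> 1"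
    and tau2: "0 < tau2" "tau2 \<le> 1"
    and iter: "\<forall>k. x (Suc k) = relaxed_op {1..m} T (w k) (lam k) (x k)"
    and lam: "\<forall>k. lam k \<in> {tau1 .. (2 - tau2) * extrapolation {1..m} T (x k) (w k)}"
    and s: "s \<ge> 1"
    and alpha: "alpha > 0"
    and intermittent: "\<forall>i\<in>{1..m}. \<forall>l. \<exists>k\<in>{l..l + s - 1}. w k i \<ge> alpha"
  shows "\<exists>xstar \<in> (\<Inter>i\<in>{1..m}. Fix (T i)). x \<longlonglongrightarrow> xstar"
proof -
  let ?I = "{1..m}"
  let ?F = "\<Inter>i\<in>?I. Fix (T i)"
  define S where "S = (\<lambda>k. \<Sum>i\<in>?I. w k i * (norm (T i (x k) - x k))\<^sup>2)"
  have dec: "tau1 * tau2 * S k \<le> (norm (x k - q))\<^sup>2 - (norm (x (Suc k) - q))\<^sup>2"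
    and step: "tau2 * (norm (x (Suc k) - x k))\<^sup>2
      \<le> 2 * ((norm (x k - q))\<^sup>2 - (norm (x (Suc k) - q))\<^sup>2)"
    if "q \<in> ?F" for q k
    using relaxed_op_decrease[of ?I "w k" T q tau1 tau2 "lam k" "x k"]
      weights cutters that tau1(1) tau2(1) lam iter
    by (auto simp: S_def)
  have antimono: "norm (x (Suc k) - q) \<le> norm (x k - q)" if "q \<in> ?F" for q k
  proof (rule power2_le_imp_le)
    have "0 \<le> tau2 * (norm (x (Suc k) - x k))\<^sup>2"
      using tau2(1) by simp
    from order_trans[OF this step[OF that]] show "(norm (x (Suc k) - q))\<^sup>2 \<le> (norm (x k - q))\<^sup>2"
      by simp
  qed simp

  obtain q where q: "q \<in> ?F"
    using common by blast
  define D where "D = (\<lambda>k. (norm (x k - q))\<^sup>2 - (norm (x (Suc k) - q))\<^sup>2)"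
  have decseq: "decseq (\<lambda>k. norm (x k - q))"
    by (rule decseq_SucI) (rule antimono[OF q])
  then obtain L where L: "(\<lambda>k. norm (x k - q)) \<longlonglongrightarrow> L"
    by (rule decseq_convergent[of _ 0]) auto
  have "D \<longlonglongrightarrow> L\<^sup>2 - L\<^sup>2"
    unfolding D_def by (intro tendsto_intros L LIMSEQ_Suc)
  then have D0: "D \<longlonglongrightarrow> 0"
    by simp
  have steps: "(\<lambda>k. x (Suc k) - x k) \<longlonglongrightarrow> 0"
  proof -
    have "(\<lambda>k. 2 / tau2 * D k) \<longlonglongrightarrow> 0"
      using tendsto_mult_right_zero[OF D0] .
    moreover have "norm ((norm (x (Suc k) - x k))\<^sup>2) \<le> 2 / tau2 * D k" for k
      using step[OF q, of k] tau2(1) by (simp add: D_def field_simps)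
    ultimately have "(\<lambda>k. (norm (x (Suc k) - x k))\<^sup>2) \<longlonglongrightarrow> 0"
      by (rule Lim_null_comparison[OF always_eventually[OF allI], rotated])
    then show ?thesis
      by (simp add: tendsto_norm_zero_iff)
  qed

  have "norm (x k) \<le> norm (x 0 - q) + norm q" for k
    using decseqD[OF decseq, of 0 k] norm_triangle_ineq[of "x k - q" q] by simp
  then have "bounded (range x)"
    by (auto simp: bounded_iff)
  then obtain xstar and r :: "nat \<Rightarrow> nat"
    where r: "strict_mono r" and lim: "(\<lambda>n. x (r n)) \<longlonglongrightarrow> xstar"
    by (rule finite_dimensional_convergent_subsequence[OF fin_dim])
  have r_top: "filterlim r at_top sequentially"
    by (rule filterlim_subseq[OF r])

  have "T i xstar = xstar" if i: "i \<in> ?I" for i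
  proof -
    (* The iterates along r may never give weight to operator i, so each index r n is moved
       forward, by at most s, to one where they do. *)
    have "\<forall>n. \<exists>k. r n \<le> k \<and> k \<le> r n + s \<and> alpha \<le> w k i"
    proof
      fix n
      obtain k where "k \<in> {r n..r n + s - 1}" "alpha \<le> w k i"
        using intermittent i by blast
      then show "\<exists>k. r n \<le> k \<and> k \<le> r n + s \<and> alpha \<le> w k i"
        by (intro exI[of _ k]) auto
    qed
    then obtain k where k: "\<And>n. r n \<le> k n" "\<And>n. k n \<le> r n + s" "\<And>n. alpha \<le> w (k n) i"
      by metis
    have xk: "(\<lambda>n. x (k n)) \<longlonglongrightarrow> xstar"
      by (rule vanishing_steps_bounded_shift[OF steps r_top k(1,2) lim])
    have Tk: "(\<lambda>n. T i (x (k n))) \<longlonglongrightarrow> T i xstar"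
      using cutters i by (intro continuous_on_tendsto_compose[OF _ xk, of UNIV]) auto
    have k_top: "filterlim k at_top sequentially"
      by (rule filterlim_at_top_mono[OF r_top]) (simp add: k(1))
    have "(\<lambda>n. 1 / (tau1 * tau2 * alpha) * D (k n)) \<longlonglongrightarrow> 0"
      using tendsto_mult_right_zero[OF filterlim_compose[OF D0 k_top]] .
    moreover have "norm ((norm (T i (x (k n)) - x (k n)))\<^sup>2)
        \<le> 1 / (tau1 * tau2 * alpha) * D (k n)" for n
    proof -
      let ?e = "\<lambda>i. (norm (T i (x (k n)) - x (k n)))\<^sup>2"
      have "alpha * ?e i \<le> w (k n) i * ?e i"
        using k(3) by (intro mult_right_mono) auto
      also have "\<dots> \<le> S (k n)"
        unfolding S_def using i weights
        by (intro member_le_sum[of i ?I "\<lambda>i. w (k n) i * ?e i"]) (auto simp: weight_function_def)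
      finally have "tau1 * tau2 * (alpha * ?e i) \<le> tau1 * tau2 * S (k n)"
        using tau1(1) tau2(1) by (intro mult_left_mono) auto
      also have "\<dots> \<le> D (k n)"
        unfolding D_def by (rule dec[OF q])
      finally show ?thesis
        using tau1(1) tau2(1) alpha by (simp add: field_simps)
    qed
    ultimately have "(\<lambda>n. (norm (T i (x (k n)) - x (k n)))\<^sup>2) \<longlonglongrightarrow> 0"
      by (rule Lim_null_comparison[OF always_eventually[OF allI], rotated])
    then have "(\<lambda>n. T i (x (k n)) - x (k n)) \<longlonglongrightarrow> 0"
      by (simp add: tendsto_norm_zero_iff)
    from LIMSEQ_unique[OF tendsto_diff[OF Tk xk] this] show ?thesis
      by simp
  qed
  then have xstar: "xstar \<in> ?F"
    by (simp add: Fix_def)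
  then have "x \<longlonglongrightarrow> xstar"
    by (rule antimono_distance_subsequence_imp_LIMSEQ[OF antimono r lim])
  with xstar show ?thesis
    by blast
qed

end
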